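(* Let $F\subset\mathbb{T}$ be a finite subset of $m$ distinct points, and let $K_F(\alpha,\beta)=Z(\alpha-\beta)$ for $(\alpha,\beta)\in F\times F$. Then: (1) $K_F(\cdot,\cdot)$ is strictly positive definite on the vector space $V_F=\mathbb{C}^F$ of all complex-valued functions on $F$; i.e. $K_F$ has rank $\#F$. (2) The $m\times m$ complex matrices $M=(M_{\alpha,\beta})_{(\alpha,\beta)\in F\times F}$ satisfying $$\sum_{\gamma\in F}\sum_{\xi\in F}\overline{M_{\gamma,\alpha}}\,Z(\gamma-\xi)\,M_{\xi,\beta}=Z(\alpha-\beta)\qquad\text{for all }(\alpha,\beta)\in F\times F$$ form a compact Lie group $G(F)$ of transformations in $V_F=\mathbb{C}^F$.
   Context: $\mathbb{T}$ is the unit circle, $e(x)=e^{i2\pi x}$; a point $e(\theta)\in\mathbb{T}$ is identified with its angular variable $\theta\in\mathbb{R}/\mathbb{Z}$. $Z(x)=\sum_{n=0}^\infty\frac{e(nx)}{1+n^2}$ (called the Hurwitz zeta-function in the paper). Matrices act on $\mathbb{C}^F$ by $(M\varphi)(\alpha)=\sum_{\beta\in F}M_{\alpha,\beta}\varphi(\beta)$. *)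

theory Defs
  imports "HOL-Analysis.Analysis" "HOL-Algebra.Group_Action"
begin

definition circ_exp :: "real \<Rightarrow> complex"
  where "circ_exp x = exp (2 * of_real pi * \<i> * of_real x)"

text \<open>The summation starts at 0 and involves no negative frequencies, so the function is
  complex-valued.\<close>

definition hurwitz_Z :: "real \<Rightarrow> complex"
  where "hurwitz_Z x = (\<Sum>n. circ_exp (real n * x) / (1 + of_nat n ^ 2))"

text \<open>A representative in the half-open interval from -1/2 (excluded) to 1/2 (included) of the
  angular variable of a point of the unit circle. Which representative is taken is immaterial,
  as shown by \<open>hurwitz_Z_periodic\<close>.\<close>

definition angle :: "complex \<Rightarrow> real"
  where "angle z = Arg z / (2 * pi)"

lemma circ_exp_angle: "norm z = 1 \<Longrightarrow> circ_exp (angle z) = z"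
  using rcis_cmod_Arg[of z]
  by (simp add: circ_exp_def angle_def rcis_def cis_conv_exp mult.commute)

lemma hurwitz_Z_periodic: "hurwitz_Z (x + of_int k) = hurwitz_Z x"
proof -
  have "circ_exp (real n * (x + of_int k)) = circ_exp (real n * x)" for n
  proof -
    have "2 * of_real pi * \<i> * of_real (real n * (x + of_int k)) =
        2 * of_real pi * \<i> * of_real (real n * x) + of_real (of_int (2 * (int n * k)) * pi) * \<i>"
      by (simp add: algebra_simps)
    then show ?thesis
      unfolding circ_exp_def exp_eq by blast
  qed
  then show ?thesis
    by (simp add: hurwitz_Z_def)
qed

definition K_kernel :: "complex \<Rightarrow> complex \<Rightarrow> complex"
  where "K_kernel \<alpha> \<beta> = hurwitz_Z (angle \<alpha> - angle \<beta>)"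

definition strictly_positive_definite_on :: "'a set \<Rightarrow> ('a \<Rightarrow> 'a \<Rightarrow> complex) \<Rightarrow> bool"
  where "strictly_positive_definite_on F K \<longleftrightarrow>
    (\<forall>\<phi> :: 'a \<Rightarrow> complex. (\<exists>\<alpha>\<in>F. \<phi> \<alpha> \<noteq> 0) \<longrightarrow>
      (let q = (\<Sum>\<alpha>\<in>F. \<Sum>\<beta>\<in>F. cnj (\<phi> \<alpha>) * K \<alpha> \<beta> * \<phi> \<beta>) in q \<in> \<real> \<and> 0 < Re q))"

text \<open>Continuous (real) Frechet differentiability of order \<open>k\<close> on an open set \<open>U\<close>.\<close>

primrec Ck_on :: "nat \<Rightarrow> 'a::euclidean_space set \<Rightarrow> ('a \<Rightarrow> 'b::euclidean_space) \<Rightarrow> bool" where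
  "Ck_on 0 U f \<longleftrightarrow> continuous_on U f"
| "Ck_on (Suc k) U f \<longleftrightarrow>
    (\<forall>x\<in>U. f differentiable (at x)) \<and> (\<forall>v. Ck_on k U (\<lambda>x. frechet_derivative f (at x) v))"

text \<open>Smoothness on an arbitrary subset of a Euclidean space: locally, the map is the
  restriction of a map that is infinitely differentiable on an open set.\<close>

definition smooth_on :: "'a::euclidean_space set \<Rightarrow> ('a \<Rightarrow> 'b::euclidean_space) \<Rightarrow> bool"
  where "smooth_on S f \<longleftrightarrow>
    (\<forall>x\<in>S. \<exists>U g. open U \<and> x \<in> U \<and> (\<forall>k. Ck_on k U g) \<and> (\<forall>y\<in>S \<inter> U. g y = f y))"

text \<open>Embedded submanifolds of dimension \<open>d\<close>: around each point some smooth
  diffeomorphism \<open>f\<close> of open sets, with inverse \<open>g\<close>, straightens the set to a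
  \<open>d\<close>-dimensional linear subspace.\<close>

definition smooth_submanifold :: "nat \<Rightarrow> 'a::euclidean_space set \<Rightarrow> bool"
  where "smooth_submanifold d S \<longleftrightarrow>
    (\<forall>x\<in>S. \<exists>U V W (f :: 'a \<Rightarrow> 'a) g.
      open U \<and> x \<in> U \<and> open V \<and> homeomorphism U V f g \<and> smooth_on U f \<and> smooth_on V g \<and>
      subspace W \<and> dim W = d \<and> f ` (S \<inter> U) = W \<inter> V)"

text \<open>The manifold structure is the one induced by the ambient Euclidean space.\<close>

definition lie_group :: "'a::euclidean_space monoid \<Rightarrow> bool"
  where "lie_group G \<longleftrightarrow>
    group G \<and> (\<exists>d. smooth_submanifold d (carrier G)) \<and>
    smooth_on (carrier G \<times> carrier G) (\<lambda>(x, y). x \<otimes>\<^bsub>G\<^esub> y) \<and>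
    smooth_on (carrier G) (\<lambda>x. inv\<^bsub>G\<^esub> x)"

definition lie_transformation_group ::
    "'a::euclidean_space monoid \<Rightarrow> ('a \<Rightarrow> 'b::euclidean_space \<Rightarrow> 'b) \<Rightarrow> bool"
  where "lie_transformation_group G act \<longleftrightarrow>
    lie_group G \<and> faithful_action G UNIV act \<and>
    smooth_on (carrier G \<times> UNIV) (\<lambda>(g, v). act g v)"

text \<open>A finite set \<open>F\<close> is enumerated by a bijection \<open>p\<close> from a finite type \<open>'n\<close> to \<open>F\<close>; functions
  on \<open>F\<close> are then vectors, and functions on \<open>F \<times> F\<close> matrices, with indices in \<open>'n\<close>.\<close>

definition K_matrix :: "('n::finite \<Rightarrow> complex) \<Rightarrow> complex ^ 'n ^ 'n"
  where "K_matrix p = (\<chi> i j. K_kernel (p i) (p j))"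

definition G_group :: "('n::finite \<Rightarrow> complex) \<Rightarrow> (complex ^ 'n ^ 'n) monoid"
  where "G_group p =
    \<lparr>carrier = {M. \<forall>\<alpha> \<beta>. (\<Sum>\<gamma>\<in>UNIV. \<Sum>\<xi>\<in>UNIV. cnj (M $ \<gamma> $ \<alpha>) * K_kernel (p \<gamma>) (p \<xi>) * M $ \<xi> $ \<beta>)
        = K_kernel (p \<alpha>) (p \<beta>)},
     monoid.mult = (**), one = mat 1\<rparr>"

end

theory Submission
  imports Defs
begin

text \<open>
  Write \<open>s n\<close> for the sum of \<open>cnj \<beta> ^ n * \<phi> \<beta>\<close> over \<open>\<beta>\<close>. Inserting the series of \<open>Z\<close> into the
  Hermitian form of the kernel gives the value \<open>\<Sum>n. \<bar>s n\<bar>\<^sup>2 / (1 + n\<^sup>2)\<close> at \<open>\<phi>\<close>. It is real and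
  nonnegative, and it can vanish only if all \<open>s n\<close> do. Then \<open>\<phi>\<close>, as a linear functional,
  annihilates every polynomial on the finite set of conjugate points, in particular those that
  isolate a single point, so \<open>\<phi> = 0\<close> (\<open>vanishing_moments\<close>, \<open>K_kernel_positive_definite\<close>). A
  strictly positive definite matrix \<open>K\<close> has trivial kernel, hence full rank.

  The matrices of the second part are the isometries of the form of \<open>K\<close>. The form dominates a
  multiple of the squared norm, and an isometry preserves its values on the basis vectors, so the
  columns of isometries are bounded; the defining equations are closed. This is compactness
  (\<open>compact_isometries\<close>).

  Let \<open>\<sigma> M\<close> be the adjoint of \<open>M\<close> with respect to the form. Then \<open>\<sigma>\<close> is real linear, reverses
  products and fixes the identity, and the isometries are the solutions of \<open>\<sigma> M ** M = mat 1\<close>. These properties alone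
  make the solutions a Lie group. Multiplication is bilinear, and inversion is the restriction of
  the linear map \<open>\<sigma>\<close>. Where \<open>1 + X\<close> is invertible, the Cayley transform \<open>X \<mapsto> (1 - X) (1 + X)\<^sup>-\<^sup>1\<close> is its
  own inverse and exchanges the group with the linear space of skew elements \<open>\<sigma> X = - X\<close>; left
  translation moves this chart to any other point (\<open>smooth_submanifold_unitaries\<close>). The charts are
  smooth because differentiating a matrix inverse only produces products with matrix inverses
  (\<open>Ck_on_matrix_inv\<close>).
\<close>

section \<open>Calculus of continuously differentiable maps\<close>

lemma Ck_on_cong:
  assumes "open U" "Ck_on k U f" "\<And>x. x \<in> U \<Longrightarrow> f x = g x"
  shows "Ck_on k U g"
  using assms(2,3)
proof (induction k arbitrary: f g)
  case 0
  then show ?case using continuous_on_cong[of U U f g] by simp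
next
  case (Suc k)
  have d: "f differentiable (at x)" if "x \<in> U" for x
    using Suc.prems that by simp
  have "g differentiable (at x)" if "x \<in> U" for x
    using d[OF that] has_derivative_transform_within_open[of f _ x UNIV U g, OF _ \<open>open U\<close> that Suc.prems(2)]
    unfolding differentiable_def by blast
  moreover have "Ck_on k U (\<lambda>x. frechet_derivative g (at x) v)" for v
  proof (rule Suc.IH)
    show "Ck_on k U (\<lambda>x. frechet_derivative f (at x) v)"
      using Suc.prems by simp
    show "frechet_derivative f (at x) v = frechet_derivative g (at x) v" if "x \<in> U" for x
      using frechet_derivative_transform_within_open[OF d[OF that] \<open>open U\<close> that Suc.prems(2)] by simp
  qed
  ultimately show ?case by simp
qed

text \<open>The iterated condition refers to the total function \<open>frechet_derivative\<close>, whose values are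
  only meaningful on \<open>U\<close>; this rule permits an explicit formula for the derivative instead.\<close>

lemma Ck_on_SucI:
  assumes "open U" and der: "\<And>x. x \<in> U \<Longrightarrow> (f has_derivative f' x) (at x)"
    and "\<And>v. Ck_on k U (\<lambda>x. f' x v)"
  shows "Ck_on (Suc k) U f"
proof -
  have "Ck_on k U (\<lambda>x. frechet_derivative f (at x) v)" for v
    by (rule Ck_on_cong[OF \<open>open U\<close> assms(3)[of v]]) (use frechet_derivative_at[OF der] in simp)
  then show ?thesis
    using der by (auto simp: differentiable_def)
qed

lemma Ck_on_SucD:
  assumes "Ck_on (Suc k) U f"
  shows "Ck_on k U f"
  using assms
proof (induction k arbitrary: f)
  case 0
  then show ?case
    by (auto intro!: continuous_at_imp_continuous_on differentiable_imp_continuous_within)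
next
  case (Suc k)
  then show ?case by (metis Ck_on.simps(2))
qed

lemma Ck_on_Suc_has_derivative:
  "Ck_on (Suc k) U f \<Longrightarrow> x \<in> U \<Longrightarrow> (f has_derivative frechet_derivative f (at x)) (at x)"
  by (simp add: frechet_derivative_works[symmetric])

lemma Ck_on_const: "open U \<Longrightarrow> Ck_on k U (\<lambda>x. c)"
proof (induction k arbitrary: c)
  case (Suc k)
  then show ?case by (intro Ck_on_SucI[where f' = "\<lambda>x v. 0"]) auto
qed simp

lemma Ck_on_linear:
  assumes "open U" "linear f"
  shows "Ck_on k U f"
proof (cases k)
  case 0
  then show ?thesis using assms by (simp add: linear_continuous_on linear_linear)
next
  case (Suc j)
  then show ?thesis
    using assms by (auto intro!: Ck_on_SucI[where f' = "\<lambda>x. f"] linear_imp_has_derivative Ck_on_const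
        simp del: Ck_on.simps)
qed

lemma Ck_on_add:
  assumes "open U" "Ck_on k U f" "Ck_on k U g"
  shows "Ck_on k U (\<lambda>x. f x + g x)"
  using assms(2,3)
proof (induction k arbitrary: f g)
  case 0
  then show ?case by (simp add: continuous_on_add)
next
  case (Suc k)
  show ?case
  proof (rule Ck_on_SucI[OF \<open>open U\<close>])
    show "((\<lambda>x. f x + g x) has_derivative
        (\<lambda>v. frechet_derivative f (at x) v + frechet_derivative g (at x) v)) (at x)" if "x \<in> U" for x
      using Suc.prems[THEN Ck_on_Suc_has_derivative, OF that] by (rule has_derivative_add)
    show "Ck_on k U (\<lambda>x. frechet_derivative f (at x) v + frechet_derivative g (at x) v)" for v
      using Suc by simp
  qed
qed

text \<open>The Leibniz rule expresses the derivative by products of the same form, with one factor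
  differentiated and the other one unchanged. That is why the induction needs
  \<open>Ck_on_SucD\<close>.\<close>

lemma Ck_on_bilinear:
  assumes "open U" "bounded_bilinear h" "Ck_on k U f" "Ck_on k U g"
  shows "Ck_on k U (\<lambda>x. h (f x) (g x))"
  using assms(3,4)
proof (induction k arbitrary: f g)
  case 0
  then show ?case using assms by (simp add: bounded_bilinear.continuous_on)
next
  case (Suc k)
  show ?case
  proof (rule Ck_on_SucI[OF \<open>open U\<close>])
    show "((\<lambda>x. h (f x) (g x)) has_derivative
        (\<lambda>v. h (f x) (frechet_derivative g (at x) v) + h (frechet_derivative f (at x) v) (g x))) (at x)"
      if "x \<in> U" for x
      using Suc.prems[THEN Ck_on_Suc_has_derivative, OF that]
      by (rule bounded_bilinear.FDERIV[OF assms(2)])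
    show "Ck_on k U (\<lambda>x. h (f x) (frechet_derivative g (at x) v) + h (frechet_derivative f (at x) v) (g x))" for v
      using Suc.prems by (intro Ck_on_add[OF \<open>open U\<close>] Suc.IH Ck_on_SucD[of k U f] Ck_on_SucD[of k U g]) simp_all
  qed
qed

lemma smooth_onI:
  assumes "open U" "S \<subseteq> U" "\<And>k. Ck_on k U f"
  shows "smooth_on S f"
  unfolding smooth_on_def using assms by blast

lemma smooth_on_cong:
  assumes "smooth_on S f" "\<And>x. x \<in> S \<Longrightarrow> f x = g x"
  shows "smooth_on S g"
  using assms unfolding smooth_on_def by (metis IntD1)

lemma smooth_on_bilinear:
  assumes "bounded_bilinear h"
  shows "smooth_on S (\<lambda>(x, y). h x y)"
proof (rule smooth_onI[OF open_UNIV subset_UNIV])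
  show "Ck_on k UNIV (\<lambda>(x, y). h x y)" for k
    unfolding case_prod_beta
    by (intro Ck_on_bilinear[OF _ assms] Ck_on_linear linear_fst linear_snd open_UNIV)
qed

section \<open>Inversion of matrices\<close>

lemma bounded_bilinear_matrix_mult:
  "bounded_bilinear ((**) :: complex^'n^'m \<Rightarrow> complex^'p^'n \<Rightarrow> complex^'p^'m)"
  unfolding bilinear_conv_bounded_bilinear[symmetric] bilinear_def linear_iff
  by (auto simp: vec_eq_iff matrix_matrix_mult_def algebra_simps sum.distrib scaleR_sum_right)

lemma bounded_bilinear_matrix_vector_mult:
  "bounded_bilinear ((*v) :: complex^'n^'m \<Rightarrow> complex^'n \<Rightarrow> complex^'m)"
  unfolding bilinear_conv_bounded_bilinear[symmetric] bilinear_def linear_iff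
  by (auto simp: vec_eq_iff matrix_vector_mult_def algebra_simps sum.distrib scaleR_sum_right)

interpretation matrix_mult: bounded_bilinear "(**) :: complex^'n^'m \<Rightarrow> complex^'p^'n \<Rightarrow> complex^'p^'m"
  by (rule bounded_bilinear_matrix_mult)

lemma matrix_inv_right: "invertible A \<Longrightarrow> A ** matrix_inv A = mat 1"
  and matrix_inv_left: "invertible A \<Longrightarrow> matrix_inv A ** A = mat 1"
  unfolding invertible_def matrix_inv_def by (metis (mono_tags, lifting) someI_ex)+

lemma matrix_inv_unique:
  fixes A B :: "'a::field^'n^'n"
  assumes "A ** B = mat 1"
  shows "matrix_inv A = B"
proof -
  have "invertible A" using assms invertible_right_inverse by blast
  then have "matrix_inv A ** (A ** B) = B"
    by (simp add: matrix_mul_assoc matrix_inv_left)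
  then show ?thesis using assms by simp
qed

lemma open_invertible: "open {A :: complex^'n^'n. invertible A}"
proof -
  have "continuous_on UNIV (det :: complex^'n^'n \<Rightarrow> complex)"
    unfolding det_def by (intro continuous_intros)
  then have "open (UNIV \<inter> (det :: complex^'n^'n \<Rightarrow> complex) -` (- {0}))"
    by (intro continuous_open_preimage) auto
  then show ?thesis
    by (simp add: invertible_det_nz vimage_def Collect_neg_eq[symmetric] Compl_eq)
qed

text \<open>By Cramer's rule the entries of the inverse are quotients of determinants.\<close>

lemma continuous_on_matrix_inv:
  "continuous_on {A :: complex^'n^'n. invertible A} matrix_inv"
proof -
  let ?c = "\<lambda>A :: complex^'n^'n. (\<chi> k j. det (\<chi> i l. if l = k then axis j 1 $ i else A $ i $ l) / det A)"
  have "matrix_inv A = ?c A" if "invertible A" for A :: "complex^'n^'n"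
  proof -
    have "A *v (matrix_inv A *v axis j 1) = axis j 1" for j
      using that by (simp add: matrix_vector_mul_assoc matrix_inv_right)
    moreover have "det A \<noteq> 0" using that by (simp add: invertible_det_nz)
    ultimately have "matrix_inv A *v axis j 1 =
        (\<chi> k. det (\<chi> i l. if l = k then axis j 1 $ i else A $ i $ l) / det A)" for j
      using cramer by blast
    moreover have "(matrix_inv A *v axis j 1) $ k = matrix_inv A $ k $ j" for j k
      by (simp add: matrix_vector_mult_def axis_def if_distrib cong: if_cong)
    ultimately show ?thesis
      by (simp add: vec_eq_iff)
  qed
  moreover have "continuous_on {A. invertible A} ?c"
  proof -
    have "continuous_on S (\<lambda>A :: complex^'n^'n. if l = k then c else A $ i $ l)" for S c i l k
      by (cases "l = k") (auto intro!: continuous_intros)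
    then show ?thesis
      unfolding det_def by (intro continuous_intros) (auto simp: invertible_det_nz det_def)
  qed
  ultimately show ?thesis
    using continuous_on_cong[of "{A. invertible A}" "{A. invertible A}" matrix_inv ?c] by simp
qed

text \<open>The resolvent identity \<open>B\<^sup>-\<^sup>1 - A\<^sup>-\<^sup>1 = - A\<^sup>-\<^sup>1 (B - A) B\<^sup>-\<^sup>1\<close> shows that the remainder of the
  linear approximation is \<open>A\<^sup>-\<^sup>1 (B - A) (A\<^sup>-\<^sup>1 - B\<^sup>-\<^sup>1)\<close>. Relative to \<open>B - A\<close> it tends to zero by
  continuity of inversion.\<close>

lemma has_derivative_matrix_inv:
  fixes A :: "complex^'n^'n"
  assumes "invertible A"
  shows "(matrix_inv has_derivative (\<lambda>E. - (matrix_inv A ** E ** matrix_inv A))) (at A)"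
proof -
  let ?I = "matrix_inv :: complex^'n^'n \<Rightarrow> complex^'n^'n"
  obtain C where C: "\<And>(X :: complex^'n^'n) (Y :: complex^'n^'n). norm (X ** Y) \<le> norm X * norm Y * C"
    and "C > 0"
    using matrix_mult.pos_bounded by blast
  obtain e where e: "e > 0" "ball A e \<subseteq> {A. invertible A}"
    using open_invertible assms open_contains_ball by (metis mem_Collect_eq)
  have lim: "(?I \<longlongrightarrow> ?I A) (at A)"
    using continuous_on_matrix_inv[where 'n = 'n] assms
    by (simp add: continuous_on_eq_continuous_at[OF open_invertible] continuous_within)
  show ?thesis
  proof (rule has_derivativeI_sandwich[OF \<open>e > 0\<close>])
    show "bounded_linear (\<lambda>E. - (?I A ** E ** ?I A))"
      by (intro bounded_linear_minus bounded_linear_compose[OF matrix_mult.bounded_linear_left]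
          matrix_mult.bounded_linear_right)
    show "((\<lambda>Y. norm (?I A) * C * C * norm (?I A - ?I Y)) \<longlongrightarrow> 0) (at A)"
      by (rule tendsto_eq_intros lim refl | simp)+
    show "norm (?I Y - ?I A - - (?I A ** (Y - A) ** ?I A)) / norm (Y - A)
        \<le> norm (?I A) * C * C * norm (?I A - ?I Y)"
      if "Y \<noteq> A" "dist Y A < e" for Y
    proof -
      have Y: "invertible Y" using that e by (auto simp: dist_commute subset_iff)
      have "?I Y - ?I A = - (?I A ** (Y - A) ** ?I Y)"
        using matrix_inv_left[OF assms] matrix_inv_right[OF Y]
        by (simp add: matrix_mult.diff_right matrix_mult.diff_left matrix_mul_assoc[symmetric])
      then have "?I Y - ?I A - - (?I A ** (Y - A) ** ?I A) = ?I A ** (Y - A) ** (?I A - ?I Y)"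
        by (simp add: matrix_mult.diff_right)
      then have "norm (?I Y - ?I A - - (?I A ** (Y - A) ** ?I A)) \<le>
          norm (?I A ** (Y - A)) * norm (?I A - ?I Y) * C"
        using C by simp
      also have "\<dots> \<le> (norm (?I A) * norm (Y - A) * C) * norm (?I A - ?I Y) * C"
        using C \<open>C > 0\<close> by (intro mult_right_mono) auto
      finally show ?thesis
        using that by (simp add: divide_le_eq mult_ac)
    qed
  qed
qed

text \<open>The derivative of the inverse is a product of the derivative of \<open>f\<close> with two copies of the
  inverse itself. Hence the inverse gains one order of differentiability in each step.\<close>

lemma Ck_on_matrix_inv:
  fixes f :: "'a::euclidean_space \<Rightarrow> complex^'n^'n"
  assumes "open U" "\<And>x. x \<in> U \<Longrightarrow> invertible (f x)" "Ck_on k U f"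
  shows "Ck_on k U (\<lambda>x. matrix_inv (f x))"
  using assms(3)
proof (induction k)
  case 0
  then show ?case
    using assms(2) by (auto intro!: continuous_on_compose2[OF continuous_on_matrix_inv])
next
  case (Suc k)
  let ?f' = "\<lambda>x v. - (matrix_inv (f x) ** frechet_derivative f (at x) v ** matrix_inv (f x))"
  show ?case
  proof (rule Ck_on_SucI[OF \<open>open U\<close>, where f' = ?f'])
    show "((\<lambda>x. matrix_inv (f x)) has_derivative ?f' x) (at x)" if "x \<in> U" for x
      using has_derivative_compose[OF Ck_on_Suc_has_derivative[OF Suc.prems that]
          has_derivative_matrix_inv[OF assms(2)[OF that]]] .
    have I: "Ck_on k U (\<lambda>x. matrix_inv (f x))"
      using Suc.IH Suc.prems by (blast intro: Ck_on_SucD)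
    have "Ck_on k U (\<lambda>x. (-1) *\<^sub>R (matrix_inv (f x) ** frechet_derivative f (at x) v ** matrix_inv (f x)))" for v
      using Suc.prems
      by (intro Ck_on_bilinear[OF \<open>open U\<close> bounded_bilinear_matrix_mult]
          Ck_on_bilinear[OF \<open>open U\<close> bounded_bilinear_scaleR] Ck_on_const[OF \<open>open U\<close>] I) simp
    then show "Ck_on k U (\<lambda>x. ?f' x v)" for v by simp
  qed
qed


section \<open>Unitary elements for a linear anti-endomorphism\<close>

text \<open>The adjoint with respect to a nondegenerate sesquilinear form has these properties. They
  suffice for the Cayley transform, and linearity is over the reals only.\<close>

locale matrix_antihom =
  fixes \<sigma> :: "complex^'n^'n \<Rightarrow> complex^'n^'n"
  assumes linear: "linear \<sigma>"
    and antimult: "\<sigma> (A ** B) = \<sigma> B ** \<sigma> A"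
    and one: "\<sigma> (mat 1) = mat 1"
begin

definition unitaries :: "(complex^'n^'n) set"
  where "unitaries = {M. \<sigma> M ** M = mat 1}"

definition unitary_group :: "(complex^'n^'n) monoid"
  where "unitary_group = \<lparr>carrier = unitaries, monoid.mult = (**), one = mat 1\<rparr>"

lemma unitary_left: "M \<in> unitaries \<Longrightarrow> \<sigma> M ** M = mat 1"
  by (simp add: unitaries_def)

lemma unitary_right: "M \<in> unitaries \<Longrightarrow> M ** \<sigma> M = mat 1"
  using unitary_left matrix_left_right_inverse by blast

lemma unitaries_mult:
  assumes "M \<in> unitaries" "N \<in> unitaries"
  shows "M ** N \<in> unitaries"
proof -
  have "\<sigma> (M ** N) ** (M ** N) = \<sigma> N ** (\<sigma> M ** M) ** N"
    by (simp add: antimult matrix_mul_assoc)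
  then show ?thesis
    using assms by (simp add: unitaries_def)
qed

lemma unitaries_inverse: "M \<in> unitaries \<Longrightarrow> \<sigma> M \<in> unitaries"
  using antimult[of M "\<sigma> M"] by (simp add: unitaries_def unitary_right one)

lemma unitaries_one: "mat 1 \<in> unitaries"
  by (simp add: unitaries_def one)

lemma group_unitary_group: "group unitary_group"
proof (rule groupI)
  show "\<exists>N\<in>carrier unitary_group. N \<otimes>\<^bsub>unitary_group\<^esub> M = \<one>\<^bsub>unitary_group\<^esub>"
    if "M \<in> carrier unitary_group" for M
    using that unitaries_inverse unitary_left by (auto simp: unitary_group_def)
qed (auto simp: unitary_group_def unitaries_mult unitaries_one matrix_mul_assoc)

lemma inv_unitary_group: "M \<in> unitaries \<Longrightarrow> inv\<^bsub>unitary_group\<^esub> M = \<sigma> M"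
  by (rule group.inv_equality[OF group_unitary_group])
    (auto simp: unitary_group_def unitaries_inverse unitary_left)

lemma inverse_of_image:
  assumes "invertible A"
  shows "\<sigma> (matrix_inv A) ** \<sigma> A = mat 1"
  using assms by (simp add: antimult[symmetric] matrix_inv_right one)

text \<open>This is \<open>(1 - X) (1 + X)\<^sup>-\<^sup>1\<close>, written with a single occurrence of the inverse so that
  \<open>1 + cayley X\<close> is a multiple of \<open>(1 + X)\<^sup>-\<^sup>1\<close>.\<close>

definition cayley :: "complex^'n^'n \<Rightarrow> complex^'n^'n"
  where "cayley X = 2 *\<^sub>R matrix_inv (mat 1 + X) - mat 1"

lemma one_plus_cayley: "mat 1 + cayley X = 2 *\<^sub>R matrix_inv (mat 1 + X)"
  by (simp add: cayley_def)

lemma one_plus_cayley_inverse: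
  assumes "invertible (mat 1 + X)"
  shows "(mat 1 + cayley X) ** ((1/2) *\<^sub>R (mat 1 + X)) = mat 1"
  using assms by (simp add: one_plus_cayley matrix_mult.scaleR_left matrix_mult.scaleR_right matrix_inv_left)

lemma invertible_one_plus_cayley:
  assumes "invertible (mat 1 + X)"
  shows "invertible (mat 1 + cayley X)"
  using one_plus_cayley_inverse[OF assms] invertible_right_inverse by blast

lemma cayley_cayley:
  assumes "invertible (mat 1 + X)"
  shows "cayley (cayley X) = X"
  unfolding cayley_def[of "cayley X"] matrix_inv_unique[OF one_plus_cayley_inverse[OF assms]] by simp

lemma Ck_on_cayley:
  assumes "open U" "\<And>x. x \<in> U \<Longrightarrow> invertible (mat 1 + f x)" "Ck_on k U f"
  shows "Ck_on k U (\<lambda>x. cayley (f x))"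
proof -
  have "Ck_on k U (\<lambda>x. 2 *\<^sub>R matrix_inv (mat 1 + f x) + (- mat 1))"
    using assms
    by (intro Ck_on_add Ck_on_bilinear[OF _ bounded_bilinear_scaleR] Ck_on_const Ck_on_matrix_inv)
  then show ?thesis by (simp add: cayley_def)
qed

text \<open>With \<open>P = (1 + M)\<^sup>-\<^sup>1\<close> the claim amounts to \<open>\<sigma> P + P = 1\<close>. Since \<open>\<sigma> M = M\<^sup>-\<^sup>1\<close>, the element
  \<open>\<sigma> P = (1 + M\<^sup>-\<^sup>1)\<^sup>-\<^sup>1\<close> equals \<open>M P\<close>, and \<open>M P + P = (1 + M) P = 1\<close>.\<close>

lemma cayley_unitary_skew:
  assumes "M \<in> unitaries" and inv: "invertible (mat 1 + M)"
  shows "\<sigma> (cayley M) = - cayley M"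
proof -
  let ?P = "matrix_inv (mat 1 + M)"
  have "\<sigma> ?P = M ** ?P"
  proof -
    have "\<sigma> (mat 1 + M) ** (M ** ?P) = (mat 1 + M) ** ?P"
      using unitary_left[OF assms(1)]
      by (simp add: linear_add[OF linear] one matrix_mul_assoc matrix_mult.add_left add.commute)
    also have "\<dots> = mat 1" by (rule matrix_inv_right[OF inv])
    finally have "\<sigma> ?P ** (\<sigma> (mat 1 + M) ** (M ** ?P)) = \<sigma> ?P" by simp
    then show ?thesis
      by (simp only: matrix_mul_assoc inverse_of_image[OF inv]) simp
  qed
  then have "\<sigma> ?P + ?P = (mat 1 + M) ** ?P"
    by (simp add: matrix_mult.add_left)
  also have "\<dots> = mat 1" by (rule matrix_inv_right[OF inv])
  finally have "\<sigma> ?P = mat 1 - ?P" by (simp add: eq_diff_eq)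
  then show ?thesis
    by (simp add: cayley_def linear_diff[OF linear] linear_scale[OF linear] one)
      (simp add: algebra_simps scaleR_2)
qed

text \<open>With \<open>P = (1 + X)\<^sup>-\<^sup>1\<close> and \<open>\<sigma> P = (1 - X)\<^sup>-\<^sup>1\<close> the equation \<open>(2 \<sigma> P - 1) (2 P - 1) = 1\<close> amounts to
  \<open>2 \<sigma> P P = \<sigma> P + P\<close>. This is the identity \<open>2 = (1 - X) + (1 + X)\<close> multiplied by \<open>\<sigma> P\<close> from the
  left and by \<open>P\<close> from the right.\<close>

lemma cayley_skew_unitary:
  assumes skew: "\<sigma> X = - X" and inv: "invertible (mat 1 + X)"
  shows "cayley X \<in> unitaries"
proof -
  let ?P = "matrix_inv (mat 1 + X)"
  have \<sigma>: "\<sigma> (mat 1 + X) = mat 1 - X"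
    by (simp add: linear_add[OF linear] one skew)
  have "\<sigma> ?P ** ((mat 1 - X) + (mat 1 + X)) ** ?P =
      (\<sigma> ?P ** (mat 1 - X)) ** ?P + \<sigma> ?P ** ((mat 1 + X) ** ?P)"
    by (simp only: matrix_mult.add_right matrix_mult.add_left matrix_mul_assoc)
  also have "\<dots> = ?P + \<sigma> ?P"
    using inverse_of_image[OF inv] matrix_inv_right[OF inv] by (simp only: \<sigma>) simp
  finally have "\<sigma> ?P ** ((mat 1 - X) + (mat 1 + X)) ** ?P = ?P + \<sigma> ?P" .
  moreover have "(mat 1 - X) + (mat 1 + X) = 2 *\<^sub>R (mat 1 :: complex^'n^'n)"
    by (simp add: scaleR_2)
  ultimately have "2 *\<^sub>R (\<sigma> ?P ** ?P) = ?P + \<sigma> ?P"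
    by (simp add: matrix_mult.scaleR_left matrix_mult.scaleR_right)
  then have "(2 *\<^sub>R \<sigma> ?P - mat 1) ** (2 *\<^sub>R ?P - mat 1) = mat 1"
    by (simp add: matrix_mult.diff_left matrix_mult.diff_right matrix_mult.scaleR_left
        matrix_mult.scaleR_right diff_eq_eq add.commute)
  then show ?thesis
    by (simp add: unitaries_def cayley_def linear_diff[OF linear] linear_scale[OF linear] one)
qed

text \<open>The chart at \<open>g\<close> translates by \<open>g\<^sup>-\<^sup>1\<close> and applies the Cayley transform, which exchanges
  unitary and skew elements in both directions. The model space does not depend on \<open>g\<close>, so
  neither does the dimension.\<close>

lemma smooth_submanifold_unitaries:
  "smooth_submanifold (dim {X. \<sigma> X = - X}) unitaries"
  unfolding smooth_submanifold_def
proof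
  fix g assume g: "g \<in> unitaries"
  define h where "h = \<sigma> g"
  have h: "h \<in> unitaries" and hg: "h ** g = mat 1" and gh: "g ** h = mat 1"
    using g by (auto simp: h_def unitaries_inverse unitary_left unitary_right)
  define V where "V = {X :: complex^'n^'n. invertible (mat 1 + X)}"
  define U where "U = {M. h ** M \<in> V}"
  let ?W = "{X. \<sigma> X = - X}"
  let ?f = "\<lambda>M. cayley (h ** M)" and ?g = "\<lambda>X. g ** cayley X"
  have cV: "cayley X \<in> V" "cayley (cayley X) = X" if "X \<in> V" for X
    using that by (simp_all add: V_def invertible_one_plus_cayley cayley_cayley)
  have hgX: "h ** (g ** X) = X" "g ** (h ** X) = X" for X :: "complex^'n^'n"
    by (simp_all add: matrix_mul_assoc hg gh)
  have "open V"
    using open_vimage[OF open_invertible, of "\<lambda>X :: complex^'n^'n. mat 1 + X"]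
    by (simp add: V_def vimage_def continuous_on_add)
  have "open U"
    using open_vimage[OF \<open>open V\<close>, of "\<lambda>X. h ** X"]
    by (simp add: U_def vimage_def linear_continuous_on[OF matrix_mult.bounded_linear_right])
  have "g \<in> U"
    \<comment> \<open>translation takes \<open>g\<close> to the identity, where the Cayley transform inverts \<open>2\<close>\<close>
  proof -
    have "(mat 1 + mat 1) ** ((1/2) *\<^sub>R mat 1) = (mat 1 :: complex^'n^'n)"
      by (simp only: matrix_mult.scaleR_right matrix_mul_rid) (simp add: scaleR_2[symmetric])
    then show ?thesis
      unfolding U_def V_def mem_Collect_eq hg invertible_right_inverse by blast
  qed
  have f: "Ck_on k U ?f" for k
    using \<open>open U\<close>
    by (intro Ck_on_cayley Ck_on_linear bounded_linear.linear[OF matrix_mult.bounded_linear_right])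
      (auto simp: U_def V_def)
  have g': "Ck_on k V ?g" for k
    using \<open>open V\<close>
    by (intro Ck_on_bilinear[OF _ bounded_bilinear_matrix_mult] Ck_on_const
        Ck_on_cayley[where f = "\<lambda>X. X"] Ck_on_linear linear_ident) (auto simp: V_def)
  have hom: "homeomorphism U V ?f ?g"
    using f[of 0] g'[of 0] by (intro homeomorphismI) (auto simp: U_def hgX cV)
  moreover have "?f ` (unitaries \<inter> U) = ?W \<inter> V"
  proof
    show "?f ` (unitaries \<inter> U) \<subseteq> ?W \<inter> V"
      using cV(1) h by (auto simp: U_def V_def intro!: cayley_unitary_skew unitaries_mult)
    show "?W \<inter> V \<subseteq> ?f ` (unitaries \<inter> U)"
    proof
      fix X assume X: "X \<in> ?W \<inter> V"
      then have "?g X \<in> unitaries \<inter> U"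
        using g by (auto simp: U_def V_def hgX intro!: unitaries_mult cayley_skew_unitary
            invertible_one_plus_cayley)
      moreover have "X = ?f (?g X)"
        using X by (simp add: hgX cV)
      ultimately show "X \<in> ?f ` (unitaries \<inter> U)" by blast
    qed
  qed
  moreover have "subspace ?W"
    by (auto simp: subspace_def linear_0[OF linear] linear_add[OF linear] linear_scale[OF linear])
  moreover have "smooth_on U ?f" "smooth_on V ?g"
    by (rule smooth_onI[OF \<open>open U\<close> order_refl f] smooth_onI[OF \<open>open V\<close> order_refl g'])+
  ultimately have "open U \<and> g \<in> U \<and> open V \<and> homeomorphism U V ?f ?g \<and> smooth_on U ?f \<and>
      smooth_on V ?g \<and> subspace ?W \<and> dim ?W = dim ?W \<and> ?f ` (unitaries \<inter> U) = ?W \<inter> V"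
    using \<open>open U\<close> \<open>g \<in> U\<close> \<open>open V\<close> by (intro conjI refl)
  then show "\<exists>U V W (f :: complex^'n^'n \<Rightarrow> complex^'n^'n) k. open U \<and> g \<in> U \<and> open V \<and> homeomorphism U V f k \<and>
      smooth_on U f \<and> smooth_on V k \<and> subspace W \<and> dim W = dim ?W \<and> f ` (unitaries \<inter> U) = W \<inter> V"
    by - (rule exI[of _ U], rule exI[of _ V], rule exI[of _ ?W], rule exI[of _ ?f], rule exI[of _ ?g])
qed

text \<open>Inversion is smooth because it agrees on the group with the linear map \<open>\<sigma>\<close>.\<close>

lemma lie_group_unitary_group: "lie_group unitary_group"
proof -
  have "smooth_on unitaries \<sigma>"
    by (rule smooth_onI[OF open_UNIV subset_UNIV Ck_on_linear[OF open_UNIV linear]])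
  then have "smooth_on unitaries (\<lambda>M. inv\<^bsub>unitary_group\<^esub> M)"
    by (rule smooth_on_cong) (simp add: inv_unitary_group)
  moreover have "carrier unitary_group = unitaries" "monoid.mult unitary_group = (**)"
    by (simp_all add: unitary_group_def)
  ultimately show ?thesis
    unfolding lie_group_def
    using group_unitary_group smooth_submanifold_unitaries smooth_on_bilinear[OF bounded_bilinear_matrix_mult]
    by auto
qed

lemma faithful_action_unitary_group: "faithful_action unitary_group UNIV (*v)"
proof -
  have Bij: "(*v) M \<in> Bij UNIV" if "M \<in> unitaries" for M
  proof -
    have "bij ((*v) M)"
      by (rule bij_betw_byWitness[where f' = "(*v) (\<sigma> M)"])
        (simp_all add: matrix_vector_mul_assoc unitary_left unitary_right that)
    then show ?thesis by (simp add: Bij_def)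
  qed
  have "(*v) \<in> hom unitary_group (BijGroup UNIV)"
    by (rule homI)
      (auto simp: unitary_group_def BijGroup_def Bij compose_def fun_eq_iff matrix_vector_mul_assoc)
  moreover have "inj_on (*v) (carrier unitary_group)"
    by (auto simp: inj_on_def matrix_eq fun_eq_iff)
  ultimately show ?thesis
    by (simp add: faithful_action_def faithful_action_axioms_def group_action_def group_hom_def
        group_hom_axioms_def group_unitary_group group_BijGroup)
qed

lemma lie_transformation_group_unitary_group: "lie_transformation_group unitary_group (*v)"
  unfolding lie_transformation_group_def
  by (intro conjI lie_group_unitary_group faithful_action_unitary_group
      smooth_on_bilinear[OF bounded_bilinear_matrix_vector_mult])

end


section \<open>Isometries of a strictly positive definite form\<close>

definition hermitian_adjoint :: "complex^'n^'m \<Rightarrow> complex^'m^'n"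
  where "hermitian_adjoint A = (\<chi> i j. cnj (A $ j $ i))"

text \<open>The adjoint of \<open>M\<close> with respect to the sesquilinear form of \<open>K\<close>.\<close>

definition form_adjoint :: "complex^'n^'n \<Rightarrow> complex^'n^'n \<Rightarrow> complex^'n^'n"
  where "form_adjoint K M = matrix_inv K ** hermitian_adjoint M ** K"

definition isometries :: "complex^'n^'n \<Rightarrow> (complex^'n^'n) set"
  where "isometries K = {M. \<forall>\<alpha> \<beta>. (\<Sum>\<gamma>\<in>UNIV. \<Sum>\<xi>\<in>UNIV. cnj (M $ \<gamma> $ \<alpha>) * K $ \<gamma> $ \<xi> * M $ \<xi> $ \<beta>) = K $ \<alpha> $ \<beta>}"

lemma hermitian_adjoint_mult: "hermitian_adjoint (A ** B) = hermitian_adjoint B ** hermitian_adjoint A"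
  by (simp add: hermitian_adjoint_def matrix_matrix_mult_def vec_eq_iff mult.commute)

lemma hermitian_adjoint_one: "hermitian_adjoint (mat 1) = mat 1"
  by (simp add: hermitian_adjoint_def mat_def vec_eq_iff eq_commute)

lemma linear_hermitian_adjoint: "linear hermitian_adjoint"
  by (rule linearI) (simp_all add: hermitian_adjoint_def vec_eq_iff)

lemma matrix_antihom_form_adjoint:
  fixes K :: "complex^'n^'n"
  assumes "invertible K"
  shows "matrix_antihom (form_adjoint K)"
proof (rule matrix_antihom.intro)
  show "linear (form_adjoint K)"
    unfolding form_adjoint_def
    by (rule linearI)
      (simp_all add: linear_add[OF linear_hermitian_adjoint] linear_scale[OF linear_hermitian_adjoint]
        matrix_mult.add_left matrix_mult.add_right matrix_mult.scaleR_left matrix_mult.scaleR_right)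
  show "form_adjoint K (mat 1) = mat 1"
    using assms by (simp add: form_adjoint_def hermitian_adjoint_one matrix_inv_left)
  show "form_adjoint K (A ** B) = form_adjoint K B ** form_adjoint K A" for A B :: "complex^'n^'n"
  proof -
    have "form_adjoint K B ** form_adjoint K A =
        matrix_inv K ** hermitian_adjoint B ** (K ** matrix_inv K) ** hermitian_adjoint A ** K"
      by (simp add: form_adjoint_def matrix_mul_assoc)
    then show ?thesis
      using assms by (simp add: form_adjoint_def hermitian_adjoint_mult matrix_inv_right matrix_mul_assoc)
  qed
qed

lemma isometries_eq:
  fixes K :: "complex^'n^'n"
  assumes "invertible K"
  shows "isometries K = {M. form_adjoint K M ** M = mat 1}"
proof -
  have "(hermitian_adjoint M ** K ** M) $ \<alpha> $ \<beta> =
      (\<Sum>\<gamma>\<in>UNIV. \<Sum>\<xi>\<in>UNIV. cnj (M $ \<gamma> $ \<alpha>) * K $ \<gamma> $ \<xi> * M $ \<xi> $ \<beta>)" for M :: "complex^'n^'n" and \<alpha> \<beta>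
    unfolding hermitian_adjoint_def matrix_matrix_mult_def
    by (simp add: sum_distrib_right) (rule sum.swap)
  then have "isometries K = {M. hermitian_adjoint M ** K ** M = K}"
    unfolding isometries_def by (simp add: vec_eq_iff)
  moreover have "hermitian_adjoint M ** K ** M = K \<longleftrightarrow> form_adjoint K M ** M = mat 1" for M
  proof
    assume *: "hermitian_adjoint M ** K ** M = K"
    have "form_adjoint K M ** M = matrix_inv K ** (hermitian_adjoint M ** K ** M)"
      by (simp add: form_adjoint_def matrix_mul_assoc)
    then show "form_adjoint K M ** M = mat 1"
      using assms by (simp add: * matrix_inv_left)
  next
    assume *: "form_adjoint K M ** M = mat 1"
    have "hermitian_adjoint M ** K ** M = (K ** matrix_inv K) ** hermitian_adjoint M ** K ** M"
      using assms by (simp add: matrix_inv_right)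
    also have "\<dots> = K ** (form_adjoint K M ** M)"
      by (simp add: form_adjoint_def matrix_mul_assoc)
    finally show "hermitian_adjoint M ** K ** M = K"
      by (simp add: *)
  qed
  ultimately show ?thesis by simp
qed

lemma positive_definite_invertible:
  fixes K :: "complex^'n^'n"
  assumes "strictly_positive_definite_on UNIV (\<lambda>i j. K $ i $ j)"
  shows "invertible K"
proof -
  have "v = 0" if "K *v v = 0" for v
  proof (rule ccontr)
    assume "v \<noteq> 0"
    then have "\<exists>i\<in>UNIV. v $ i \<noteq> 0" by (simp add: vec_eq_iff)
    then have "0 < Re (\<Sum>i\<in>UNIV. \<Sum>j\<in>UNIV. cnj (v $ i) * K $ i $ j * v $ j)"
      using assms unfolding strictly_positive_definite_on_def Let_def by blast
    also have "(\<Sum>i\<in>UNIV. \<Sum>j\<in>UNIV. cnj (v $ i) * K $ i $ j * v $ j) =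
        (\<Sum>i\<in>UNIV. cnj (v $ i) * (K *v v) $ i)"
      by (simp add: matrix_vector_mult_def sum_distrib_left mult.assoc)
    finally show False using that by simp
  qed
  then show ?thesis
    using matrix_left_invertible_ker invertible_left_inverse by blast
qed

lemma rank_invertible:
  fixes K :: "'a::field^'n^'n"
  assumes "invertible K"
  shows "rank K = CARD('n)"
proof -
  have "vec.span (rows K) = UNIV"
    using assms matrix_left_invertible_span_rows_gen invertible_left_inverse by blast
  then show ?thesis
    unfolding row_rank_def_gen by (metis vec.dim_span vec_dim_card)
qed

text \<open>By homogeneity it suffices to bound the form from below on the unit sphere, where it attains
  a positive minimum.\<close>

lemma positive_definite_coercive:
  fixes K :: "complex^'n^'n"
  assumes "strictly_positive_definite_on UNIV (\<lambda>i j. K $ i $ j)"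
  obtains c where "c > 0"
    "\<And>v :: complex^'n. c * (norm v)\<^sup>2 \<le> Re (\<Sum>i\<in>UNIV. \<Sum>j\<in>UNIV. cnj (v $ i) * K $ i $ j * v $ j)"
proof -
  let ?q = "\<lambda>v :: complex^'n. Re (\<Sum>i\<in>UNIV. \<Sum>j\<in>UNIV. cnj (v $ i) * K $ i $ j * v $ j)"
  have "sphere (0 :: complex^'n) 1 \<noteq> {}" by simp
  moreover have "continuous_on (sphere 0 1) ?q"
    by (intro continuous_intros)
  ultimately obtain u where u: "norm u = 1" and min: "\<And>v. norm v = 1 \<Longrightarrow> ?q u \<le> ?q v"
    using continuous_attains_inf[OF compact_sphere, of 0 1 ?q] by auto
  have "\<exists>i\<in>UNIV. u $ i \<noteq> 0"
    using u by (metis UNIV_I norm_zero vec_eq_iff zero_index zero_neq_one)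
  then have "?q u > 0"
    using assms unfolding strictly_positive_definite_on_def Let_def by blast
  moreover have "?q u * (norm v)\<^sup>2 \<le> ?q v" for v
  proof (cases "v = 0")
    case False
    have scale: "?q (r *\<^sub>R w) = r\<^sup>2 * ?q w" for r w
    proof -
      have "cnj ((r *\<^sub>R w) $ i) * K $ i $ j * (r *\<^sub>R w) $ j = of_real (r\<^sup>2) * (cnj (w $ i) * K $ i $ j * w $ j)" for i j
        by (simp only: vector_scaleR_component) (simp add: scaleR_conv_of_real power2_eq_square mult_ac)
      then have "(\<Sum>i\<in>UNIV. \<Sum>j\<in>UNIV. cnj ((r *\<^sub>R w) $ i) * K $ i $ j * (r *\<^sub>R w) $ j) =
          of_real (r\<^sup>2) * (\<Sum>i\<in>UNIV. \<Sum>j\<in>UNIV. cnj (w $ i) * K $ i $ j * w $ j)"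
        by (simp only: sum_distrib_left)
      then show ?thesis
        by (simp only: times_complex.sel Re_complex_of_real Im_complex_of_real mult_zero_left diff_zero)
    qed
    let ?w = "(1 / norm v) *\<^sub>R v"
    have "?q u * (norm v)\<^sup>2 \<le> ?q ?w * (norm v)\<^sup>2"
      using False by (intro mult_right_mono min) simp_all
    also have "\<dots> = ?q (norm v *\<^sub>R ?w)"
      unfolding scale[of "norm v" ?w] by (rule mult.commute)
    also have "norm v *\<^sub>R ?w = v" using False by simp
    finally show ?thesis .
  qed simp
  ultimately show thesis using that by blast
qed

text \<open>For \<open>\<alpha> = \<beta>\<close> the defining equation says that the form takes the value \<open>K $ \<alpha> $ \<alpha>\<close> at column
  \<open>\<alpha>\<close> of \<open>M\<close>; coercivity then bounds that column independently of \<open>M\<close>.\<close>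

lemma compact_isometries:
  fixes K :: "complex^'n^'n"
  assumes "strictly_positive_definite_on UNIV (\<lambda>i j. K $ i $ j)"
  shows "compact (isometries K)"
proof -
  obtain c where c: "c > 0"
    "\<And>v :: complex^'n. c * (norm v)\<^sup>2 \<le> Re (\<Sum>i\<in>UNIV. \<Sum>j\<in>UNIV. cnj (v $ i) * K $ i $ j * v $ j)"
    using positive_definite_coercive[OF assms] by blast
  define B where "B = (\<Sum>a\<in>UNIV. sqrt (Re (K $ a $ a) / c))"
  have entry: "norm (M $ i $ a) \<le> sqrt (Re (K $ a $ a) / c)" if "M \<in> isometries K" for M i a
  proof -
    have "c * (norm (\<chi> i. M $ i $ a))\<^sup>2 \<le> Re (K $ a $ a)"
      using c(2)[of "\<chi> i. M $ i $ a"] that unfolding isometries_def mem_Collect_eq vec_lambda_beta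
      by (simp only:)
    then have "norm (\<chi> i. M $ i $ a) \<le> sqrt (Re (K $ a $ a) / c)"
      using c(1) by (intro real_le_rsqrt) (simp add: field_simps)
    then show ?thesis
      using Finite_Cartesian_Product.norm_nth_le[of "\<chi> i. M $ i $ a" i] by simp
  qed
  have "norm M \<le> (\<Sum>i\<in>(UNIV :: 'n set). B)" if "M \<in> isometries K" for M
  proof -
    have "norm M \<le> (\<Sum>i\<in>UNIV. norm (M $ i))"
      by (simp add: norm_vec_def L2_set_le_sum)
    also have "\<dots> \<le> (\<Sum>i\<in>UNIV. \<Sum>a\<in>UNIV. norm (M $ i $ a))"
      by (intro sum_mono) (simp add: norm_vec_def[of "M $ _"] L2_set_le_sum)
    also have "\<dots> \<le> (\<Sum>i\<in>(UNIV :: 'n set). B)"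
      unfolding B_def using entry[OF that] by (intro sum_mono)
    finally show ?thesis .
  qed
  then have "bounded (isometries K)"
    unfolding bounded_iff by blast
  moreover have "closed (isometries K)"
    unfolding isometries_def by (intro closed_Collect_all closed_Collect_eq continuous_intros)
  ultimately show ?thesis
    by (simp add: compact_eq_bounded_closed)
qed

section \<open>Positive definiteness of the kernel\<close>

text \<open>This is the injectivity of a Vandermonde matrix. The hypothesis extends by linearity from
  powers to all polynomials, and the product \<open>L\<close> of the linear factors of the other points
  isolates the term at \<open>j\<close>.\<close>

lemma vanishing_moments:
  fixes x :: "'i \<Rightarrow> 'a::field"
  assumes "finite I" "inj_on x I" and moments: "\<And>n. (\<Sum>i\<in>I. x i ^ n * c i) = 0" and "j \<in> I"
  shows "c j = 0"
proof -
  define L where "L = (\<Prod>i\<in>I - {j}. [:- x i, 1:])"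
  have L: "poly L y = (\<Prod>i\<in>I - {j}. y - x i)" for y
    by (simp add: L_def poly_prod)
  have "(\<Sum>i\<in>I. poly L (x i) * c i) = (\<Sum>i\<in>I. \<Sum>n\<le>degree L. coeff L n * (x i ^ n * c i))"
    by (simp add: poly_altdef sum_distrib_right mult.assoc)
  also have "\<dots> = (\<Sum>n\<le>degree L. coeff L n * (\<Sum>i\<in>I. x i ^ n * c i))"
    by (subst sum.swap) (simp add: sum_distrib_left)
  also have "\<dots> = 0" by (simp add: moments)
  finally have "(\<Sum>i\<in>I. poly L (x i) * c i) = 0" .
  moreover have "poly L (x i) = 0" if "i \<in> I" "i \<noteq> j" for i
    unfolding L using that \<open>finite I\<close> by (intro prod_zero) auto
  then have "(\<Sum>i\<in>I. poly L (x i) * c i) = poly L (x j) * c j"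
    using assms(1,4) by (simp add: sum.remove[of I j])
  moreover have "poly L (x j) \<noteq> 0"
    unfolding L using assms by (auto simp: inj_on_def)
  ultimately show ?thesis by simp
qed

lemma circ_exp_diff_power:
  assumes "norm a = 1" "norm b = 1"
  shows "circ_exp (real n * (angle a - angle b)) = a ^ n * cnj b ^ n"
proof -
  have "circ_exp (angle a - angle b) = circ_exp (angle a) * cnj (circ_exp (angle b))"
    by (simp add: circ_exp_def exp_cnj exp_diff exp_minus divide_inverse algebra_simps)
  also have "\<dots> = a * cnj b" using assms by (simp add: circ_exp_angle)
  finally have "circ_exp (angle a - angle b) = a * cnj b" .
  moreover have "circ_exp (real n * t) = circ_exp t ^ n" for t
    by (simp add: circ_exp_def exp_of_nat_mult[symmetric] mult_ac)
  ultimately show ?thesis by (simp add: power_mult_distrib)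
qed

lemma K_kernel_sums:
  assumes "norm a = 1" "norm b = 1"
  shows "(\<lambda>n. a ^ n * cnj b ^ n / (1 + of_nat n ^ 2)) sums K_kernel a b"
proof -
  let ?t = "\<lambda>n. a ^ n * cnj b ^ n / (1 + of_nat n ^ 2)"
  have "summable ?t"
  proof (rule summable_comparison_test'[where N = 1])
    show "summable (\<lambda>n. inverse (real n ^ 2))"
      by (rule inverse_power_summable) simp
    show "norm (?t n) \<le> inverse (real n ^ 2)" if "n \<ge> 1" for n
    proof -
      have "norm (1 + of_nat n ^ 2 :: complex) = norm (of_real (1 + real n ^ 2) :: complex)"
        by simp
      also have "\<dots> = 1 + real n ^ 2"
        unfolding norm_of_real by (simp add: add_nonneg_nonneg)
      finally show ?thesis
        using that assms add_pos_nonneg[of 1 "(real n)\<^sup>2"]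
        by (simp add: norm_divide norm_mult norm_power divide_simps)
    qed
  qed
  then show ?thesis
    using assms by (simp add: K_kernel_def hurwitz_Z_def circ_exp_diff_power summable_sums)
qed

text \<open>Every frequency contributes a matrix of rank one, so the form is a weighted sum of the
  squares \<open>\<bar>s n\<bar>\<^sup>2\<close>. It is positive as soon as one moment \<open>s n\<close> is different from zero.\<close>

lemma K_kernel_positive_definite:
  assumes "finite I" "inj_on x I" and unit: "\<And>i. i \<in> I \<Longrightarrow> norm (x i) = 1"
  shows "strictly_positive_definite_on I (\<lambda>i j. K_kernel (x i) (x j))"
  unfolding strictly_positive_definite_on_def Let_def
proof (intro allI impI)
  fix \<phi> :: "'a \<Rightarrow> complex"
  assume "\<exists>i\<in>I. \<phi> i \<noteq> 0"
  let ?q = "\<Sum>i\<in>I. \<Sum>j\<in>I. cnj (\<phi> i) * K_kernel (x i) (x j) * \<phi> j"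
  define s where "s n = (\<Sum>i\<in>I. cnj (x i) ^ n * \<phi> i)" for n
  define r where "r n = (norm (s n))\<^sup>2 / (1 + real n ^ 2)" for n
  have "(\<lambda>n. \<Sum>i\<in>I. \<Sum>j\<in>I. cnj (\<phi> i) * (x i ^ n * cnj (x j) ^ n / (1 + of_nat n ^ 2)) * \<phi> j) sums ?q"
    using unit by (intro sums_sum sums_mult sums_mult2 K_kernel_sums)
  moreover have "(\<Sum>i\<in>I. \<Sum>j\<in>I. cnj (\<phi> i) * (x i ^ n * cnj (x j) ^ n / (1 + of_nat n ^ 2)) * \<phi> j) =
      of_real (r n)" for n
  proof -
    have "cnj (s n) * s n = (\<Sum>i\<in>I. \<Sum>j\<in>I. (x i ^ n * cnj (\<phi> i)) * (cnj (x j) ^ n * \<phi> j))"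
      by (simp add: s_def sum_product)
    then have "(\<Sum>i\<in>I. \<Sum>j\<in>I. cnj (\<phi> i) * (x i ^ n * cnj (x j) ^ n / (1 + of_nat n ^ 2)) * \<phi> j) =
        cnj (s n) * s n / (1 + of_nat n ^ 2)"
      by (simp add: sum_divide_distrib mult_ac)
    also have "cnj (s n) * s n = of_real ((norm (s n))\<^sup>2)"
      by (simp only: complex_norm_square mult.commute)
    also have "\<dots> / (1 + of_nat n ^ 2) = of_real (r n)"
      by (simp add: r_def)
    finally show ?thesis .
  qed
  ultimately have sums: "(\<lambda>n. complex_of_real (r n)) sums ?q" by simp
  have "Im ?q = 0"
    using sums_Im[OF sums] by (simp add: sums_iff)
  moreover have "0 < Re ?q"
  proof -
    obtain n where "s n \<noteq> 0"
    proof (rule ccontr)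
      assume "\<not> thesis"
      then have "\<And>n. s n = 0" using that by blast
      moreover have "inj_on (\<lambda>i. cnj (x i)) I"
        using \<open>inj_on x I\<close> by (simp add: inj_on_def)
      ultimately have "\<phi> i = 0" if "i \<in> I" for i
        using vanishing_moments[OF \<open>finite I\<close>, of "\<lambda>i. cnj (x i)" \<phi> i] that by (simp add: s_def)
      then show False using \<open>\<exists>i\<in>I. \<phi> i \<noteq> 0\<close> by blast
    qed
    then have "0 < r n"
      by (simp add: r_def add_pos_nonneg)
    moreover have "0 \<le> r n" for n
      by (simp add: r_def)
    moreover have "r sums Re ?q"
      using sums_Re[OF sums] by simp
    ultimately show ?thesis
      using suminf_pos2[of r n] by (simp add: sums_iff)
  qed
  ultimately show "?q \<in> \<real> \<and> 0 < Re ?q"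
    by (simp add: complex_is_Real_iff)
qed

theorem corollary6p24:
  fixes F :: "complex set" and p :: "'n::finite \<Rightarrow> complex"
  assumes "F \<subseteq> sphere 0 1"
    and "bij_betw p UNIV F"
  shows "(strictly_positive_definite_on F K_kernel \<and> rank (K_matrix p) = card F) \<and>
    (compact (carrier (G_group p)) \<and> lie_transformation_group (G_group p) (*v))"
proof -
  have F: "F = range p" and "inj p" and unit: "norm (p i) = 1" for i
    using assms by (auto simp: bij_betw_def subset_iff)
  have "strictly_positive_definite_on F (\<lambda>\<alpha> \<beta>. K_kernel (id \<alpha>) (id \<beta>))"
    using unit by (intro K_kernel_positive_definite) (auto simp: F)
  moreover have K: "strictly_positive_definite_on UNIV (\<lambda>i j. K_matrix p $ i $ j)"
    using K_kernel_positive_definite[OF finite \<open>inj p\<close> unit] by (simp add: K_matrix_def)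
  note inv = positive_definite_invertible[OF K]
  interpret matrix_antihom "form_adjoint (K_matrix p)"
    by (rule matrix_antihom_form_adjoint[OF inv])
  have isometries: "isometries (K_matrix p) = unitaries"
    by (simp add: isometries_eq[OF inv] unitaries_def)
  have "carrier (G_group p) = isometries (K_matrix p)"
    by (simp add: G_group_def isometries_def K_matrix_def)
  then have "G_group p = unitary_group"
    by (simp add: G_group_def unitary_group_def flip: isometries)
  moreover have "compact unitaries"
    using compact_isometries[OF K] by (simp only: isometries)
  moreover have "card F = CARD('n)"
    using assms(2) bij_betw_same_card by metis
  ultimately show ?thesis
    using rank_invertible[OF inv] lie_transformation_group_unitary_group
    by (simp add: unitary_group_def)
qed

end
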